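(* The Maximum Mean Discrepancy (MMD) test with a characteristic kernel is universally detection coherent. That is, with null hypothesis $\mathcal H_0=\{(F,G):F=G\}$ and detection-null set $\mathcal D_0=\{(F,G):\mathrm{MMD}^2(F,G)=0\}$, where the MMD is taken with respect to a characteristic kernel, one has $\mathcal D_0=\mathcal H_0$, so the blind spot $\mathcal S_{\mathcal P}=\mathcal D_0\setminus\mathcal H_0$ is empty.
   Context: $\mathcal P$ is the distribution space, consisting of pairs $(F,G)$ of distributions. $\mathrm{MMD}^2(F,G)$ is the squared distance, in the reproducing kernel Hilbert space of the kernel, between the mean embeddings of $F$ and $G$. The kernel is characteristic if the mean embedding is injective on distributions. The MMD test is calibrated under the null $\mathcal H_0$. Its detector is the unbiased $U$-statistic estimator $\widehat{\mathrm{MMD}}{}_u^2$, consistent for $\mathrm{MMD}^2(F,G)$ on all of $\mathcal P$. The detection functional is $\theta(F,G)=\mathrm{MMD}^2(F,G)$, with common value $\theta^*=0$ on $\mathcal H_0$. The detection-null set is $\mathcal D_0=\{\theta=\theta^*\}$ and the blind spot is $\mathcal S_{\mathcal P}=\mathcal D_0\setminus\mathcal H_0$. A test is universally detection coherent if $\mathcal S_{\mathcal P}=\emptyset$. *)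

theory Defs
  imports "HOL-Probability.Probability"
begin

section \<open>Reproducing kernel Hilbert spaces\<close>

text \<open>
  Real-valued functions on the sample space \<^term>\<open>space X\<close> are encoded as functions on the
  whole type that vanish outside \<^term>\<open>space X\<close>, so that equality of functions is equality
  on the sample space.
\<close>

definition kernel_section :: "'x measure \<Rightarrow> ('x \<Rightarrow> 'x \<Rightarrow> real) \<Rightarrow> 'x \<Rightarrow> 'x \<Rightarrow> real" where
  "kernel_section X k x = (\<lambda>y. if y \<in> space X then k x y else 0)"

text \<open>
  \<open>H\<close> with inner product \<open>ip\<close> is the reproducing kernel Hilbert space of the measurable kernel
  \<open>k\<close> on \<open>X\<close>.  Only the values of \<open>ip\<close> on \<open>H\<close> matter.
\<close>

locale rkhs =
  fixes X :: "'x measure"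
    and k :: "'x \<Rightarrow> 'x \<Rightarrow> real"
    and H :: "('x \<Rightarrow> real) set"
    and ip :: "('x \<Rightarrow> real) \<Rightarrow> ('x \<Rightarrow> real) \<Rightarrow> real"
  assumes kernel_measurable: "(\<lambda>(x, y). k x y) \<in> borel_measurable (X \<Otimes>\<^sub>M X)"
    and kernel_sym: "\<And>x y. x \<in> space X \<Longrightarrow> y \<in> space X \<Longrightarrow> k x y = k y x"
    and kernel_psd: "\<And>A c. finite A \<Longrightarrow> A \<subseteq> space X \<Longrightarrow>
          0 \<le> (\<Sum>x\<in>A. \<Sum>y\<in>A. c x * c y * k x y)"
    and vanish_outside: "\<And>f x. f \<in> H \<Longrightarrow> x \<notin> space X \<Longrightarrow> f x = 0"
    and zero_mem: "(\<lambda>x. 0) \<in> H"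
    and add_mem: "\<And>f g. f \<in> H \<Longrightarrow> g \<in> H \<Longrightarrow> (\<lambda>x. f x + g x) \<in> H"
    and scale_mem: "\<And>f c. f \<in> H \<Longrightarrow> (\<lambda>x. c * f x) \<in> H"
    and ip_sym: "\<And>f g. f \<in> H \<Longrightarrow> g \<in> H \<Longrightarrow> ip f g = ip g f"
    and ip_add_left: "\<And>f g h. f \<in> H \<Longrightarrow> g \<in> H \<Longrightarrow> h \<in> H \<Longrightarrow>
          ip (\<lambda>x. f x + g x) h = ip f h + ip g h"
    and ip_scale_left: "\<And>f g c. f \<in> H \<Longrightarrow> g \<in> H \<Longrightarrow> ip (\<lambda>x. c * f x) g = c * ip f g"
    and ip_nonneg: "\<And>f. f \<in> H \<Longrightarrow> 0 \<le> ip f f"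
    and ip_definite: "\<And>f. f \<in> H \<Longrightarrow> ip f f = 0 \<Longrightarrow> f = (\<lambda>x. 0)"
    and complete: "\<And>u :: nat \<Rightarrow> 'x \<Rightarrow> real.
          (\<And>n. u n \<in> H) \<Longrightarrow>
          (\<forall>e>0. \<exists>N. \<forall>m\<ge>N. \<forall>n\<ge>N.
             sqrt (ip (\<lambda>x. u m x - u n x) (\<lambda>x. u m x - u n x)) < e) \<Longrightarrow>
          (\<exists>f\<in>H. (\<lambda>n. sqrt (ip (\<lambda>x. u n x - f x) (\<lambda>x. u n x - f x))) \<longlonglongrightarrow> 0)"
    and section_mem: "\<And>x. x \<in> space X \<Longrightarrow> kernel_section X k x \<in> H"
    and reproducing: "\<And>f x. f \<in> H \<Longrightarrow> x \<in> space X \<Longrightarrow> f x = ip f (kernel_section X k x)"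


section \<open>Mean embeddings, characteristic kernels and the MMD\<close>

definition distributions :: "'x measure \<Rightarrow> 'x measure set" where
  "distributions X = space (prob_algebra X)"

text \<open>The mean embedding of \<open>F\<close> is the element of \<open>H\<close> representing \<open>f \<mapsto> E_F f\<close>.\<close>

definition is_mean_embedding ::
    "('x \<Rightarrow> real) set \<Rightarrow> (('x \<Rightarrow> real) \<Rightarrow> ('x \<Rightarrow> real) \<Rightarrow> real) \<Rightarrow>
     'x measure \<Rightarrow> ('x \<Rightarrow> real) \<Rightarrow> bool" where
  "is_mean_embedding H ip F m \<longleftrightarrow>
     m \<in> H \<and> (\<forall>f\<in>H. integrable F f \<and> ip f m = (\<integral>x. f x \<partial>F))"

definition mean_embedding ::
    "('x \<Rightarrow> real) set \<Rightarrow> (('x \<Rightarrow> real) \<Rightarrow> ('x \<Rightarrow> real) \<Rightarrow> real) \<Rightarrow>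
     'x measure \<Rightarrow> 'x \<Rightarrow> real" where
  "mean_embedding H ip F = (THE m. is_mean_embedding H ip F m)"

text \<open>
  The first conjunct says that the mean embedding is a map defined on all distributions; without
  it, \<^const>\<open>mean_embedding\<close> could take unspecified values.
\<close>

definition characteristic ::
    "'x measure \<Rightarrow> ('x \<Rightarrow> real) set \<Rightarrow> (('x \<Rightarrow> real) \<Rightarrow> ('x \<Rightarrow> real) \<Rightarrow> real) \<Rightarrow> bool" where
  "characteristic X H ip \<longleftrightarrow>
     (\<forall>F\<in>distributions X. \<exists>m. is_mean_embedding H ip F m) \<and>
     inj_on (mean_embedding H ip) (distributions X)"

definition mmd_sq ::
    "('x \<Rightarrow> real) set \<Rightarrow> (('x \<Rightarrow> real) \<Rightarrow> ('x \<Rightarrow> real) \<Rightarrow> real) \<Rightarrow>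
     'x measure \<times> 'x measure \<Rightarrow> real" where
  "mmd_sq H ip = (\<lambda>(F, G).
     let d = (\<lambda>x. mean_embedding H ip F x - mean_embedding H ip G x) in ip d d)"

text \<open>
  The unbiased estimator of the squared MMD from the first \<open>m\<close> terms of the sample \<open>x\<close> and the
  first \<open>n\<close> terms of the sample \<open>y\<close> (meaningful for \<open>m, n \<ge> 2\<close>).
\<close>

definition mmd_u_sq ::
    "('x \<Rightarrow> 'x \<Rightarrow> real) \<Rightarrow> nat \<Rightarrow> nat \<Rightarrow> (nat \<Rightarrow> 'x) \<times> (nat \<Rightarrow> 'x) \<Rightarrow> real" where
  "mmd_u_sq k m n = (\<lambda>(x, y).
       (\<Sum>i<m. \<Sum>j\<in>{..<m} - {i}. k (x i) (x j)) / (real m * (real m - 1))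
     + (\<Sum>i<n. \<Sum>j\<in>{..<n} - {i}. k (y i) (y j)) / (real n * (real n - 1))
     - 2 * (\<Sum>i<m. \<Sum>j<n. k (x i) (y j)) / (real m * real n))"


section \<open>Two-sample tests and detection coherence\<close>

definition distribution_space :: "'x measure \<Rightarrow> ('x measure \<times> 'x measure) set" where
  "distribution_space X = distributions X \<times> distributions X"

definition equality_null :: "'x measure \<Rightarrow> ('x measure \<times> 'x measure) set" where
  "equality_null X = {(F, G). (F, G) \<in> distribution_space X \<and> F = G}"

text \<open>Independent infinite i.i.d. samples from \<open>F\<close> and from \<open>G\<close>.\<close>

definition two_sample :: "'x measure \<times> 'x measure \<Rightarrow> ((nat \<Rightarrow> 'x) \<times> (nat \<Rightarrow> 'x)) measure" where
  "two_sample = (\<lambda>(F, G). (\<Pi>\<^sub>M i\<in>UNIV. F) \<Otimes>\<^sub>M (\<Pi>\<^sub>M i\<in>UNIV. G))"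

text \<open>Convergence in probability as both sample sizes tend to infinity.\<close>

definition consistent_for ::
    "('x measure \<times> 'x measure) set \<Rightarrow>
     (nat \<Rightarrow> nat \<Rightarrow> (nat \<Rightarrow> 'x) \<times> (nat \<Rightarrow> 'x) \<Rightarrow> real) \<Rightarrow>
     ('x measure \<times> 'x measure \<Rightarrow> real) \<Rightarrow> bool" where
  "consistent_for \<P> T \<theta> \<longleftrightarrow>
     (\<forall>p\<in>\<P>. (\<forall>m n. T m n \<in> borel_measurable (two_sample p)) \<and>
        (\<forall>e>0. ((\<lambda>(m, n). measure (two_sample p)
                    {\<omega> \<in> space (two_sample p). \<bar>T m n \<omega> - \<theta> p\<bar> > e}) \<longlongrightarrow> 0)
               (sequentially \<times>\<^sub>F sequentially)))"

text \<open>
  A test of the null \<open>H0\<close> on the distribution space \<open>\<P>\<close> whose detector \<open>T\<close> has detection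
  functional \<open>\<theta>\<close>, with common value \<open>\<theta>s\<close> on the null.
\<close>

definition detection_test ::
    "('x measure \<times> 'x measure) set \<Rightarrow> ('x measure \<times> 'x measure) set \<Rightarrow>
     (nat \<Rightarrow> nat \<Rightarrow> (nat \<Rightarrow> 'x) \<times> (nat \<Rightarrow> 'x) \<Rightarrow> real) \<Rightarrow>
     ('x measure \<times> 'x measure \<Rightarrow> real) \<Rightarrow> real \<Rightarrow> bool" where
  "detection_test \<P> H0 T \<theta> \<theta>s \<longleftrightarrow>
     H0 \<subseteq> \<P> \<and> consistent_for \<P> T \<theta> \<and> (\<forall>p\<in>H0. \<theta> p = \<theta>s)"

definition detection_null :: "'p set \<Rightarrow> ('p \<Rightarrow> real) \<Rightarrow> real \<Rightarrow> 'p set" where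
  "detection_null \<P> \<theta> \<theta>s = {p \<in> \<P>. \<theta> p = \<theta>s}"

definition blind_spot :: "'p set \<Rightarrow> 'p set \<Rightarrow> ('p \<Rightarrow> real) \<Rightarrow> real \<Rightarrow> 'p set" where
  "blind_spot \<P> H0 \<theta> \<theta>s = detection_null \<P> \<theta> \<theta>s - H0"

definition universally_detection_coherent ::
    "('x measure \<times> 'x measure) set \<Rightarrow> ('x measure \<times> 'x measure) set \<Rightarrow>
     (nat \<Rightarrow> nat \<Rightarrow> (nat \<Rightarrow> 'x) \<times> (nat \<Rightarrow> 'x) \<Rightarrow> real) \<Rightarrow>
     ('x measure \<times> 'x measure \<Rightarrow> real) \<Rightarrow> real \<Rightarrow> bool" where
  "universally_detection_coherent \<P> H0 T \<theta> \<theta>s \<longleftrightarrow>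
     detection_test \<P> H0 T \<theta> \<theta>s \<and> blind_spot \<P> H0 \<theta> \<theta>s = {}"

end

theory Submission
  imports Defs
begin

text \<open>
  Injectivity of the mean embedding and definiteness of the inner product give \<open>MMD\<^sup>2(F,G) = 0\<close>
  only for \<open>F = G\<close>; the work lies in the consistency of the \<open>U\<close>-statistic.  As mean embeddings exist
  for all distributions, including discrete ones with arbitrary atoms, every function in \<open>H\<close>
  is bounded, and uniform boundedness makes the kernel bounded.  The empirical embedding of an
  i.i.d. sample of size \<open>m\<close> then lies within expected squared distance \<open>B/m\<close> of the mean
  embedding.  The squared distance of the two empirical embeddings differs from the
  \<open>U\<close>-statistic by \<open>O(1/m + 1/n)\<close>, and Markov's inequality concludes.
\<close>

section \<open>Marginals of product measures\<close>

text \<open>Rectangles determine the product of sigma-finite measures, and the preimage of a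
  rectangle is a cylinder over two distinct coordinates, whose measure factorises. This is the form
  of independence that evaluates \<open>E k(x_i, x_j)\<close> off the diagonal.\<close>

lemma distr_PiM_two_components:
  assumes "prob_space F" and "i \<noteq> (j :: 'i)"
  shows "distr (\<Pi>\<^sub>M l\<in>(UNIV :: 'i set). F) (F \<Otimes>\<^sub>M F) (\<lambda>\<omega>. (\<omega> i, \<omega> j)) = F \<Otimes>\<^sub>M F"
proof (rule pair_measure_eqI[symmetric])
  interpret F: prob_space F by fact
  show "sigma_finite_measure F" "sigma_finite_measure F" by unfold_locales
  fix A B assume AB: "A \<in> sets F" "B \<in> sets F"
  let ?P = "\<Pi>\<^sub>M l\<in>(UNIV :: 'i set). F"
  let ?S = "\<lambda>l. if l = i then A else B"
  have "emeasure (distr ?P (F \<Otimes>\<^sub>M F) (\<lambda>\<omega>. (\<omega> i, \<omega> j))) (A \<times> B)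
      = emeasure ?P ((\<lambda>\<omega>. (\<omega> i, \<omega> j)) -` (A \<times> B) \<inter> space ?P)"
    using AB by (intro emeasure_distr) auto
  also have "(\<lambda>\<omega>. (\<omega> i, \<omega> j)) -` (A \<times> B) \<inter> space ?P = prod_emb UNIV (\<lambda>_. F) {i, j} (Pi\<^sub>E {i, j} ?S)"
    using \<open>i \<noteq> j\<close> by (auto simp: prod_emb_def space_PiM PiE_iff)
  also have "emeasure ?P \<dots> = (\<Prod>l\<in>{i, j}. emeasure F (?S l))"
    using AB by (intro emeasure_PiM_emb F.prob_space_axioms) auto
  also have "\<dots> = emeasure F A * emeasure F B"
    using \<open>i \<noteq> j\<close> by simp
  finally show "emeasure F A * emeasure F B
      = emeasure (distr ?P (F \<Otimes>\<^sub>M F) (\<lambda>\<omega>. (\<omega> i, \<omega> j))) (A \<times> B)" by simp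
qed simp

lemma distr_pair_snd:
  assumes "prob_space M" "prob_space N"
  shows "distr (M \<Otimes>\<^sub>M N) N snd = N"
proof (rule measure_eqI)
  interpret M: prob_space M by fact
  interpret N: prob_space N by fact
  fix A assume "A \<in> sets (distr (M \<Otimes>\<^sub>M N) N snd)"
  then have A: "A \<in> sets N" by simp
  then have "snd -` A \<inter> space (M \<Otimes>\<^sub>M N) = space M \<times> A"
    using sets.sets_into_space by (auto simp: space_pair_measure)
  then show "emeasure (distr (M \<Otimes>\<^sub>M N) N snd) A = emeasure N A"
    using A by (simp add: emeasure_distr N.emeasure_pair_measure_Times M.emeasure_space_1)
qed simp

lemma distributionsD:
  assumes "F \<in> distributions X"
  shows "prob_space F" "sets F = sets X" "space F = space X"
  using assms by (auto simp: distributions_def space_prob_algebra dest: sets_eq_imp_space_eq)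

section \<open>Inner product algebra, Cauchy-Schwarz and point evaluation\<close>

context rkhs
begin

lemma diff_mem: "f \<in> H \<Longrightarrow> g \<in> H \<Longrightarrow> (\<lambda>x. f x - g x) \<in> H"
  using add_mem[of f "\<lambda>x. - 1 * g x"] scale_mem[of g "-1"] by simp

lemma ip_add_right: "f \<in> H \<Longrightarrow> g \<in> H \<Longrightarrow> h \<in> H \<Longrightarrow> ip h (\<lambda>x. f x + g x) = ip h f + ip h g"
  by (simp add: ip_sym[of h] add_mem ip_add_left)

lemma ip_scale_right: "f \<in> H \<Longrightarrow> g \<in> H \<Longrightarrow> ip g (\<lambda>x. c * f x) = c * ip g f"
  by (simp add: ip_sym[of g] scale_mem ip_scale_left)

lemma ip_diff_left:
  "f \<in> H \<Longrightarrow> g \<in> H \<Longrightarrow> h \<in> H \<Longrightarrow> ip (\<lambda>x. f x - g x) h = ip f h - ip g h"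
  using ip_add_left[of f "\<lambda>x. - 1 * g x" h] scale_mem[of g "-1"] ip_scale_left[of g h "-1"] by simp

lemma ip_diff_right:
  "f \<in> H \<Longrightarrow> g \<in> H \<Longrightarrow> h \<in> H \<Longrightarrow> ip h (\<lambda>x. f x - g x) = ip h f - ip h g"
  by (simp add: ip_sym[of h] diff_mem ip_diff_left)

lemma ip_diff_diff:
  "f \<in> H \<Longrightarrow> g \<in> H \<Longrightarrow>
    ip (\<lambda>x. f x - g x) (\<lambda>x. f x - g x) = ip f f - 2 * ip f g + ip g g"
  by (simp add: ip_diff_left ip_diff_right diff_mem ip_sym[of g f])

lemma ip_add_add:
  "f \<in> H \<Longrightarrow> g \<in> H \<Longrightarrow>
    ip (\<lambda>x. f x + g x) (\<lambda>x. f x + g x) = ip f f + 2 * ip f g + ip g g"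
  by (simp add: ip_add_left ip_add_right add_mem ip_sym[of g f])

lemma ip_scale_scale: "f \<in> H \<Longrightarrow> ip (\<lambda>x. c * f x) (\<lambda>x. c * f x) = c\<^sup>2 * ip f f"
  by (simp add: ip_scale_left ip_scale_right scale_mem power2_eq_square)

lemma ip_zero_left: "f \<in> H \<Longrightarrow> ip (\<lambda>x. 0) f = 0"
  using ip_scale_left[of f f 0] by simp

lemma sum_mem: "(\<And>i. i \<in> I \<Longrightarrow> u i \<in> H) \<Longrightarrow> (\<lambda>x. \<Sum>i\<in>I. u i x) \<in> H"
  by (induction I rule: infinite_finite_induct) (auto simp: zero_mem add_mem)

lemma ip_sum_left:
  "(\<And>i. i \<in> I \<Longrightarrow> u i \<in> H) \<Longrightarrow> f \<in> H \<Longrightarrow> ip (\<lambda>x. \<Sum>i\<in>I. u i x) f = (\<Sum>i\<in>I. ip (u i) f)"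
  by (induction I rule: infinite_finite_induct)
    (auto simp: ip_zero_left ip_add_left sum_mem)

lemma ip_section_section:
  "x \<in> space X \<Longrightarrow> y \<in> space X \<Longrightarrow> ip (kernel_section X k x) (kernel_section X k y) = k x y"
  by (simp add: reproducing[symmetric] section_mem) (simp add: kernel_section_def)

text \<open>Expand the nonnegative squared norms of \<open>\<delta> * v + w\<close> and
  \<open>\<delta> * v - w\<close>. The free weight is chosen twice: balanced for Cauchy-Schwarz, and
  small when the cross term of the squared MMD is controlled.\<close>

lemma two_ip_le_weighted:
  assumes "v \<in> H" "w \<in> H" and "\<delta> > 0"
  shows "2 * \<bar>ip v w\<bar> \<le> \<delta> * ip v v + ip w w / \<delta>"
proof -
  have "0 \<le> \<delta>\<^sup>2 * ip v v + 2 * \<delta> * ip v w + ip w w"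
    using ip_nonneg[of "\<lambda>x. \<delta> * v x + w x"] assms
    by (simp add: ip_add_add add_mem scale_mem ip_scale_left ip_scale_right power2_eq_square mult.assoc)
  moreover have "0 \<le> \<delta>\<^sup>2 * ip v v - 2 * \<delta> * ip v w + ip w w"
    using ip_nonneg[of "\<lambda>x. \<delta> * v x - w x"] assms
    by (simp add: ip_diff_diff diff_mem scale_mem ip_scale_left ip_scale_right power2_eq_square mult.assoc)
  ultimately have "2 * \<delta> * \<bar>ip v w\<bar> \<le> \<delta>\<^sup>2 * ip v v + ip w w"
    by (auto simp: abs_if)
  then show ?thesis
    using \<open>\<delta> > 0\<close> by (simp add: field_simps power2_eq_square)
qed

lemma cauchy_schwarz:
  assumes "v \<in> H" "w \<in> H"
  shows "\<bar>ip v w\<bar> \<le> sqrt (ip v v) * sqrt (ip w w)"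
proof -
  \<comment> \<open>The balancing weight is the quotient of the two norms, so null vectors are
    treated apart; by definiteness they vanish.\<close>
  consider "ip v v = 0" | "ip w w = 0" | "ip v v > 0" "ip w w > 0"
    using ip_nonneg[OF assms(1)] ip_nonneg[OF assms(2)] by linarith
  then show ?thesis
  proof cases
    case 1
    then have "v = (\<lambda>x. 0)" using ip_definite assms by blast
    then show ?thesis using assms by (simp add: ip_zero_left)
  next
    case 2
    then have "w = (\<lambda>x. 0)" using ip_definite assms by blast
    then show ?thesis using assms ip_zero_left ip_sym by simp
  next
    case 3
    define a b where "a = sqrt (ip v v)" and "b = sqrt (ip w w)"
    have ab: "a > 0" "b > 0" "ip v v = a * a" "ip w w = b * b"
      using 3 by (simp_all add: a_def b_def)
    \<comment> \<open>With weight \<open>b / a\<close> both terms of the weighted bound equal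
      \<open>a * b\<close>.\<close>
    then show ?thesis
      using two_ip_le_weighted[OF assms, of "b / a"]
      unfolding a_def[symmetric] b_def[symmetric] by (simp add: field_simps)
  qed
qed

lemma norm_triangle:
  assumes "f \<in> H" "g \<in> H" "h \<in> H"
  shows "sqrt (ip (\<lambda>x. f x - h x) (\<lambda>x. f x - h x))
    \<le> sqrt (ip (\<lambda>x. f x - g x) (\<lambda>x. f x - g x)) + sqrt (ip (\<lambda>x. g x - h x) (\<lambda>x. g x - h x))"
proof -
  let ?v = "\<lambda>x. f x - g x" and ?w = "\<lambda>x. g x - h x"
  have vw: "?v \<in> H" "?w \<in> H" using assms diff_mem by auto
  have "(\<lambda>x. f x - h x) = (\<lambda>x. ?v x + ?w x)" by (simp add: fun_eq_iff)
  then have "ip (\<lambda>x. f x - h x) (\<lambda>x. f x - h x) = ip ?v ?v + 2 * ip ?v ?w + ip ?w ?w"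
    using ip_add_add[OF vw] by simp
  also have "\<dots> \<le> (sqrt (ip ?v ?v) + sqrt (ip ?w ?w))\<^sup>2"
    using cauchy_schwarz[OF vw] ip_nonneg vw by (simp add: power2_sum)
  finally show ?thesis
    using ip_nonneg vw by (simp add: real_le_lsqrt)
qed

text \<open>Evaluation at \<open>x\<close> is the inner product with the section at
  \<open>x\<close>, whose norm is \<open>sqrt (k x x)\<close>.\<close>

lemma abs_eval_le:
  assumes "f \<in> H" "x \<in> space X"
  shows "\<bar>f x\<bar> \<le> sqrt (ip f f) * sqrt (k x x)"
  using cauchy_schwarz[OF assms(1) section_mem[OF assms(2)]]
  by (simp add: reproducing[OF assms, symmetric] ip_section_section assms)

lemma abs_kernel_le:
  assumes "x \<in> space X" "y \<in> space X"
  shows "\<bar>k x y\<bar> \<le> sqrt (k x x) * sqrt (k y y)"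
  using abs_eval_le[of "kernel_section X k x" y] assms
  by (simp add: section_mem ip_section_section) (simp add: kernel_section_def)

lemma kernel_diag_nonneg: "x \<in> space X \<Longrightarrow> 0 \<le> k x x"
  using ip_nonneg[OF section_mem, of x] by (simp add: ip_section_section)

section \<open>Uniform boundedness: an unbounded kernel contradicts integrability\<close>

lemma ip_diff_commute:
  "f \<in> H \<Longrightarrow> g \<in> H \<Longrightarrow>
    ip (\<lambda>x. f x - g x) (\<lambda>x. f x - g x) = ip (\<lambda>x. g x - f x) (\<lambda>x. g x - f x)"
  by (simp add: ip_diff_diff ip_sym[of g f])

text \<open>
  Sokal's gliding-hump proof of the uniform boundedness principle: if the norms of the sections
  grow fast enough along points \<open>p n\<close>, then suitably signed multiples of them sum to an element
  of \<open>H\<close> that grows exponentially along \<open>p n\<close>.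
\<close>

lemma gliding_hump:
  assumes p: "\<And>n. p n \<in> space X" and large: "\<And>n. 144 ^ n < k (p n) (p n)"
  shows "\<exists>\<phi>\<in>H. \<forall>n. 4 ^ n / 2 \<le> \<bar>\<phi> (p n)\<bar>"
proof -
  \<comment> \<open>\<open>s n\<close> is the norm of the section at \<open>p n\<close>. Since 144 =
    12^2, it exceeds 12^n; the weights (1/3)^n used below leave the growth 4^n.\<close>
  define s where "s n = sqrt (k (p n) (p n))" for n
  have s: "12 ^ n < s n" for n
  proof -
    have "(12 ^ n)\<^sup>2 = (144 :: real) ^ n"
      by (simp add: power2_eq_square flip: power_mult_distrib)
    then show ?thesis
      using large[of n] unfolding s_def by (intro real_less_rsqrt) simp
  qed
  have s_pos: "0 < s n" for n
    using s[of n] by (rule less_trans[rotated]) simp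
  have ss: "k (p n) (p n) = s n * s n" for n
    using kernel_diag_nonneg[OF p] by (simp add: s_def)
  \<comment> \<open>\<open>c\<close> will be the value already attained at \<open>p n\<close>.
    Giving the increment the same sign (plus at 0) prevents cancellation there, and dividing by
    \<open>s n\<close> makes its norm exactly (1/3)^n.\<close>
  define d where "d c n = (\<lambda>z. (if c \<ge> (0::real) then 1 else - 1) * ((1/3) ^ n / s n)
    * kernel_section X k (p n) z)" for c n
  define f where "f = rec_nat (\<lambda>z. 0) (\<lambda>n f z. f z + d (f (p n)) n z)"
  have f_0: "f 0 = (\<lambda>z. 0)" and f_Suc: "f (Suc n) = (\<lambda>z. f n z + d (f n (p n)) n z)" for n
    by (simp_all add: f_def)
  have d_mem: "d c n \<in> H" for c n
    unfolding d_def by (intro scale_mem section_mem p)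
  have f_mem: "f n \<in> H" for n
    by (induction n) (simp_all add: f_0 f_Suc zero_mem add_mem d_mem)
  have norm_d: "sqrt (ip (d c n) (d c n)) = (1/3) ^ n" for c n
  proof -
    have "ip (d c n) (d c n) = ((1/3) ^ n)\<^sup>2"
      unfolding d_def ip_scale_scale[OF section_mem[OF p]] using s_pos[of n]
      by (simp add: p ip_section_section ss field_simps power2_eq_square)
    then show ?thesis by simp
  qed
  have hump: "(1/3) ^ n * s n \<le> \<bar>f (Suc n) (p n)\<bar>" for n
  proof -
    have "0 < (1/3) ^ n * s n" using s_pos[of n] by simp
    moreover have "f (Suc n) (p n) = f n (p n) + (if f n (p n) \<ge> 0 then 1 else - 1) * ((1/3) ^ n * s n)"
      using s_pos[of n] by (simp add: f_Suc d_def kernel_section_def p ss)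
    ultimately show ?thesis by (auto simp: abs_if)
  qed
  define N where "N g h = sqrt (ip (\<lambda>x. g x - h x) (\<lambda>x. g x - h x))" for g h :: "'x \<Rightarrow> real"
  have N_sym: "N g h = N h g" if "g \<in> H" "h \<in> H" for g h
    unfolding N_def using ip_diff_commute[OF that] by simp
  have step: "N (f (Suc n)) (f n) = (1/3) ^ n" for n
    using norm_d by (simp add: N_def f_Suc)
  \<comment> \<open>The right-hand side is the exact sum of the \<open>j\<close> increment norms
    (1/3)^n, ..., (1/3)^(n+j-1).\<close>
  have "N (f (n + j)) (f n) \<le> 3/2 * (1/3) ^ n * (1 - (1/3) ^ j)" for n j
  proof (induction j)
    case 0
    show ?case by (simp add: N_def ip_zero_left zero_mem)
  next
    case (Suc j)
    have "N (f (n + Suc j)) (f n) \<le> (1/3) ^ (n + j) + N (f (n + j)) (f n)"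
      using norm_triangle[OF f_mem f_mem f_mem, of "Suc (n + j)" n "n + j"] step[of "n + j"]
      by (simp add: N_def)
    also note Suc
    also have "(1/3) ^ (n + j) + 3/2 * (1/3) ^ n * (1 - (1/3) ^ j)
        = 3/2 * (1/3) ^ n * (1 - (1/3) ^ Suc j :: real)"
      by (simp add: power_add field_simps)
    finally show ?case by simp
  qed
  moreover have "3/2 * (1/3) ^ n * (1 - (1/3) ^ j) \<le> 3/2 * (1/3 :: real) ^ n" for n j
    by (intro mult_left_le) (auto simp: power_le_one)
  ultimately have tail: "N (f m) (f n) \<le> 3/2 * (1/3) ^ n" if "n \<le> m" for m n
    using le_Suc_ex[OF that] order_trans by blast
  have "\<exists>L. \<forall>m\<ge>L. \<forall>n\<ge>L. N (f m) (f n) < e" if "e > 0" for e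
  proof -
    have "(\<lambda>n. 3 * (1/3 :: real) ^ n) \<longlonglongrightarrow> 3 * 0"
      by (intro tendsto_intros LIMSEQ_power_zero) simp
    then have "eventually (\<lambda>n. 3 * (1/3 :: real) ^ n < e) sequentially"
      using \<open>e > 0\<close> by (intro order_tendstoD) simp_all
    then obtain L where L: "3 * (1/3 :: real) ^ L < e"
      by (auto simp: eventually_sequentially)
    have "N (f m) (f n) < e" if "L \<le> m" "L \<le> n" for m n
    proof -
      have "N (f m) (f n) \<le> N (f m) (f L) + N (f n) (f L)"
        using norm_triangle[OF f_mem f_mem f_mem, of m n L] N_sym[OF f_mem f_mem, of n L]
        by (simp add: N_def)
      then show ?thesis
        using tail[OF that(1)] tail[OF that(2)] L by simp
    qed
    then show ?thesis by blast
  qed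
  then obtain \<phi> where \<phi>: "\<phi> \<in> H" and lim: "(\<lambda>n. N (f n) \<phi>) \<longlonglongrightarrow> 0"
    using complete[of f] f_mem unfolding N_def by blast
  \<comment> \<open>The tail bound at \<open>Suc n\<close> is 3/2 * (1/3)^(n+1) = 1/2 * (1/3)^n.
    Evaluation at \<open>p n\<close> costs a factor \<open>s n\<close>, so passing to the limit
    loses at most half of the hump \<open>(1/3) ^ n * s n\<close>.\<close>
  have dist: "N (f (Suc n)) \<phi> \<le> 1/2 * (1/3) ^ n" for n
  proof (rule LIMSEQ_le_const)
    show "(\<lambda>m. 1/2 * (1/3) ^ n + N (f m) \<phi>) \<longlonglongrightarrow> 1/2 * (1/3) ^ n"
      using tendsto_add[OF tendsto_const lim] by simp
    have "N (f (Suc n)) \<phi> \<le> 1/2 * (1/3) ^ n + N (f m) \<phi>" if "m \<ge> Suc n" for m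
      using norm_triangle[OF f_mem f_mem \<phi>, of "Suc n" m] N_sym[OF f_mem f_mem, of "Suc n" m]
        tail[OF that] by (simp add: N_def)
    then show "\<exists>L. \<forall>m\<ge>L. N (f (Suc n)) \<phi> \<le> 1/2 * (1/3) ^ n + N (f m) \<phi>" by blast
  qed
  have "4 ^ n / 2 \<le> \<bar>\<phi> (p n)\<bar>" for n
  proof -
    have "\<bar>f (Suc n) (p n) - \<phi> (p n)\<bar> \<le> N (f (Suc n)) \<phi> * s n"
      using abs_eval_le[OF diff_mem[OF f_mem \<phi>] p, of "Suc n" n] by (simp add: N_def s_def)
    also have "\<dots> \<le> 1/2 * (1/3) ^ n * s n"
      using dist s_pos[of n] by (intro mult_right_mono) auto
    finally have "1/2 * (1/3) ^ n * s n \<le> \<bar>\<phi> (p n)\<bar>"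
      using hump[of n] by linarith
    moreover have "1/2 * (1/3) ^ n * 12 ^ n \<le> 1/2 * (1/3) ^ n * s n"
      using s[of n] by (intro mult_left_mono) auto
    moreover have "1/2 * (1/3) ^ n * 12 ^ n = (4 ^ n / 2 :: real)"
      using power_mult_distrib[of "1/3 :: real" 12 n] by simp
    ultimately show ?thesis by linarith
  qed
  then show ?thesis using \<phi> by blast
qed

text \<open>Otherwise the gliding hump gives an element of \<open>H\<close> of size at least 4^n / 2
  along points \<open>p n\<close>. The law of \<open>p\<close> under a geometric variable gives
  index \<open>n\<close> the mass (1/2)^(n+1), so the terms of the expectation grow like 2^n and
  that element is not integrable. Taking a push-forward allows the points to repeat.\<close>

lemma kernel_diag_bounded:
  assumes int: "\<And>F f. F \<in> distributions X \<Longrightarrow> f \<in> H \<Longrightarrow> integrable F f"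
  shows "\<exists>B. \<forall>x\<in>space X. k x x \<le> B"
proof (rule ccontr)
  assume "\<not> ?thesis"
  then have "\<forall>n. \<exists>x\<in>space X. 144 ^ n < k x x"
    by (meson not_le)
  then obtain p where p: "\<And>n :: nat. p n \<in> space X" "\<And>n. 144 ^ n < k (p n) (p n)"
    by metis
  obtain \<phi> where \<phi>: "\<phi> \<in> H" and large: "\<And>n. 4 ^ n / 2 \<le> \<bar>\<phi> (p n)\<bar>"
    using gliding_hump[OF p] by blast
  have p_meas: "p \<in> measurable (measure_pmf (geometric_pmf (1/2))) X"
    using p(1) by simp
  let ?F = "distr (measure_pmf (geometric_pmf (1/2))) X p"
  have "?F \<in> distributions X"
    unfolding distributions_def space_prob_algebra
    using measure_pmf.prob_space_distr[OF p_meas] by simp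
  then have "integrable (measure_pmf (geometric_pmf (1/2))) (\<lambda>n. \<phi> (p n))"
    using integrable_distr[OF p_meas] int \<phi> by blast
  then have "summable (\<lambda>n. norm ((1/2) ^ n * (1/2) * \<phi> (p n)))"
    by (simp add: measure_pmf_eq_density integrable_density integrable_count_space_nat_iff)
  then have "(\<lambda>n. norm ((1/2) ^ n * (1/2) * \<phi> (p n))) \<longlonglongrightarrow> 0"
    by (rule summable_LIMSEQ_zero)
  \<comment> \<open>The terms are at least 2^n / 4, hence never below 1/4.\<close>
  then have "eventually (\<lambda>n. norm ((1/2) ^ n * (1/2) * \<phi> (p n)) < 1/4) sequentially"
    by (rule order_tendstoD) simp
  then obtain n where "(1/2) ^ n * (1/2) * \<bar>\<phi> (p n)\<bar> < 1/4"
    by (auto simp: eventually_sequentially abs_mult)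
  moreover have "(1/2) ^ n * (1/2) * (4 ^ n / 2) \<le> (1/2) ^ n * (1/2) * \<bar>\<phi> (p n)\<bar>"
    by (intro mult_left_mono large) auto
  moreover have "(1/2) ^ n * (1/2) * (4 ^ n / 2) = (2 ^ n / 4 :: real)"
    using power_mult_distrib[of "1/2 :: real" 4 n] by simp
  ultimately show False
    using one_le_power[of "2::real" n] by linarith
qed

section \<open>Mean embeddings and the zero set of the squared MMD\<close>

lemma kernel_measurable':
  assumes "f \<in> measurable M X" "g \<in> measurable M X"
  shows "(\<lambda>\<omega>. k (f \<omega>) (g \<omega>)) \<in> borel_measurable M"
  using measurable_compose[OF measurable_Pair[OF assms] kernel_measurable] by simp

text \<open>The difference of two representers is orthogonal to all of \<open>H\<close>, itself
  included. This makes the definite description in \<open>mean_embedding\<close> meaningful.\<close>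

lemma mean_embedding_unique:
  assumes "is_mean_embedding H ip F m" "is_mean_embedding H ip F m'"
  shows "m = m'"
proof -
  have mem: "m \<in> H" "m' \<in> H" and eq: "\<And>f. f \<in> H \<Longrightarrow> ip f m = ip f m'"
    using assms by (auto simp: is_mean_embedding_def)
  have "ip (\<lambda>x. m x - m' x) (\<lambda>x. m x - m' x) = 0"
    using ip_diff_right[OF mem diff_mem[OF mem]] eq[OF diff_mem[OF mem]] by simp
  then have "(\<lambda>x. m x - m' x) = (\<lambda>x. 0)"
    using ip_definite diff_mem[OF mem] by blast
  then show ?thesis by (simp add: fun_eq_iff)
qed

lemma is_mean_embedding_mean_embedding:
  assumes "characteristic X H ip" "F \<in> distributions X"
  shows "is_mean_embedding H ip F (mean_embedding H ip F)"
proof -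
  obtain m where m: "is_mean_embedding H ip F m"
    using assms by (auto simp: characteristic_def)
  show ?thesis
    unfolding mean_embedding_def
    using theI[of "is_mean_embedding H ip F", OF m mean_embedding_unique[OF _ m]] .
qed

text \<open>The existence half of \<open>characteristic\<close> is what enters: a mean embedding of
  \<open>F\<close> makes every element of \<open>H\<close> integrable under
  \<open>F\<close>.\<close>

lemma characteristic_kernel_diag_bounded:
  assumes "characteristic X H ip"
  shows "\<exists>B. \<forall>x\<in>space X. k x x \<le> B"
  using assms by (intro kernel_diag_bounded) (auto simp: characteristic_def is_mean_embedding_def)

lemma mmd_sq_eq_0_iff:
  assumes char: "characteristic X H ip" and F: "F \<in> distributions X" and G: "G \<in> distributions X"
  shows "mmd_sq H ip (F, G) = 0 \<longleftrightarrow> F = G"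
proof
  let ?m = "mean_embedding H ip F" and ?n = "mean_embedding H ip G"
  have mem: "?m \<in> H" "?n \<in> H"
    using is_mean_embedding_mean_embedding[OF char] F G by (auto simp: is_mean_embedding_def)
  assume "mmd_sq H ip (F, G) = 0"
  then have "(\<lambda>x. ?m x - ?n x) = (\<lambda>x. 0)"
    using ip_definite[OF diff_mem[OF mem]] by (simp add: mmd_sq_def Let_def)
  then have "?m = ?n" by (simp add: fun_eq_iff)
  then show "F = G"
    using char F G by (auto simp: characteristic_def inj_on_def)
qed (simp add: mmd_sq_def Let_def ip_zero_left zero_mem)

section \<open>Empirical embeddings and their squared error\<close>

text \<open>The mean embedding of the empirical measure of the first \<open>m\<close> sample points;
  for \<open>m = 0\<close> it is the zero function.\<close>

definition empirical_embedding :: "nat \<Rightarrow> (nat \<Rightarrow> 'x) \<Rightarrow> 'x \<Rightarrow> real" where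
  "empirical_embedding m x = (\<lambda>z. 1 / real m * (\<Sum>i<m. kernel_section X k (x i) z))"

definition sq_error :: "('x \<Rightarrow> real) \<Rightarrow> nat \<Rightarrow> (nat \<Rightarrow> 'x) \<Rightarrow> real" where
  "sq_error \<mu> m x = ip (\<lambda>z. empirical_embedding m x z - \<mu> z) (\<lambda>z. empirical_embedding m x z - \<mu> z)"

lemma empirical_embedding_mem:
  assumes "\<And>i. x i \<in> space X"
  shows "empirical_embedding m x \<in> H"
  unfolding empirical_embedding_def by (intro scale_mem sum_mem section_mem assms)

lemma ip_empirical_left:
  assumes "\<And>i. x i \<in> space X" "f \<in> H"
  shows "ip (empirical_embedding m x) f = (\<Sum>i<m. f (x i)) / m"
  unfolding empirical_embedding_def ip_scale_left[OF sum_mem[OF section_mem[OF assms(1)]] assms(2)]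
  by (simp add: ip_sum_left section_mem assms ip_sym[OF section_mem[OF assms(1)] assms(2)]
      flip: reproducing)

text \<open>For \<open>y = x\<close> and \<open>n = m\<close> this is the
  \<open>V\<close>-statistic, diagonal included, to which the \<open>U\<close>-statistic is
  compared.\<close>

lemma ip_empirical_empirical:
  assumes x: "\<And>i. x i \<in> space X" and y: "\<And>i. y i \<in> space X"
  shows "ip (empirical_embedding m x) (empirical_embedding n y)
    = (\<Sum>i<m. \<Sum>j<n. k (x i) (y j)) / (real m * real n)"
proof -
  have "empirical_embedding n y (x i) = (\<Sum>j<n. k (x i) (y j)) / n" for i
    using x y by (simp add: empirical_embedding_def kernel_section_def kernel_sym[of "x i"])
  then show ?thesis
    by (simp add: ip_empirical_left[OF x empirical_embedding_mem[OF y]] sum_divide_distrib[symmetric])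
qed

lemma sq_error_eq:
  assumes x: "\<And>i. x i \<in> space X" and "\<mu> \<in> H"
  shows "sq_error \<mu> m x = (\<Sum>i<m. \<Sum>j<m. k (x i) (x j)) / (real m * real m)
    - 2 * ((\<Sum>i<m. \<mu> (x i)) / m) + ip \<mu> \<mu>"
  unfolding sq_error_def
  by (simp add: ip_diff_diff empirical_embedding_mem assms ip_empirical_left[OF x \<open>\<mu> \<in> H\<close>]
      ip_empirical_empirical)

lemma sq_error_nonneg:
  assumes "\<And>i. x i \<in> space X" and "\<mu> \<in> H"
  shows "0 \<le> sq_error \<mu> m x"
  unfolding sq_error_def by (intro ip_nonneg diff_mem empirical_embedding_mem assms)

end

section \<open>Moment and deviation bounds for a bounded kernel\<close>

text \<open>Only the diagonal is bounded; Cauchy-Schwarz extends the bound to all pairs. The sign of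
  \<open>B\<close> is a separate assumption because the diagonal says nothing when
  \<open>space X\<close> is empty.\<close>

locale bounded_rkhs = rkhs X k H ip for X :: "'x measure" and k H ip +
  fixes B :: real
  assumes kernel_diag_le: "\<And>x. x \<in> space X \<Longrightarrow> k x x \<le> B"
    and bound_nonneg: "0 \<le> B"
begin

lemma abs_kernel_le_bound:
  assumes "x \<in> space X" "y \<in> space X"
  shows "\<bar>k x y\<bar> \<le> B"
proof -
  have "sqrt (k x x) * sqrt (k y y) \<le> sqrt B * sqrt B"
    using assms by (intro mult_mono) (auto simp: kernel_diag_le kernel_diag_nonneg bound_nonneg)
  then show ?thesis
    using abs_kernel_le[OF assms] bound_nonneg by simp
qed

lemma integrable_kernel:
  assumes "prob_space M" "f \<in> measurable M X" "g \<in> measurable M X"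
  shows "integrable M (\<lambda>\<omega>. k (f \<omega>) (g \<omega>))"
proof -
  interpret prob_space M by fact
  show ?thesis
    using measurable_space[OF assms(2)] measurable_space[OF assms(3)]
    by (intro integrable_const_bound[where B = B] AE_I2 kernel_measurable' assms)
      (simp add: abs_kernel_le_bound)
qed

text \<open>
  The squared error has mean \<open>(E k(x,x) - ip \<mu> \<mu>) / m\<close>, because \<open>E k(x\<^sub>i,x\<^sub>j) = ip \<mu> \<mu>\<close> for
  independent \<open>x\<^sub>i\<close>, \<open>x\<^sub>j\<close>: only the diagonal terms survive the centring.
\<close>

lemma expected_sq_error:
  assumes F: "F \<in> distributions X" and \<mu>: "is_mean_embedding H ip F \<mu>" and "m > 0"
  shows "integrable (\<Pi>\<^sub>M i\<in>(UNIV :: nat set). F) (sq_error \<mu> m)"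
    and "(\<integral>x. sq_error \<mu> m x \<partial>(\<Pi>\<^sub>M i\<in>(UNIV :: nat set). F)) \<le> B / m"
proof -
  interpret F: prob_space F using F by (rule distributionsD)
  let ?P = "\<Pi>\<^sub>M i\<in>(UNIV :: nat set). F"
  interpret P: prob_space ?P by (intro prob_space_PiM F.prob_space_axioms)
  interpret FF: pair_prob_space F F ..
  note [measurable_cong] = distributionsD(2)[OF F]
  note space_F = distributionsD(3)[OF F]
  have \<mu>_mem: "\<mu> \<in> H" and \<mu>_int: "\<And>f. f \<in> H \<Longrightarrow> integrable F f \<and> ip f \<mu> = (\<integral>x. f x \<partial>F)"
    using \<mu> by (auto simp: is_mean_embedding_def)
  have comp: "(\<lambda>x. x i) \<in> measurable ?P F" "(\<lambda>x. x i) \<in> measurable ?P X" for i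
    by measurable
  have x_in: "x i \<in> space X" if "x \<in> space ?P" for x i
    using that by (auto simp: space_PiM space_F)
  \<comment> \<open>Testing the representer against the section at \<open>y\<close> identifies it
    pointwise as a kernel average, so that Fubini applies to the double integral below.\<close>
  have \<mu>_eq: "\<mu> y = (\<integral>x. k y x \<partial>F)" if "y \<in> space X" for y
  proof -
    have "\<mu> y = (\<integral>x. kernel_section X k y x \<partial>F)"
      using \<mu>_int[OF section_mem[OF that]] reproducing[OF \<mu>_mem that]
      by (simp add: ip_sym[OF \<mu>_mem section_mem[OF that]])
    also have "\<dots> = (\<integral>x. k y x \<partial>F)"
      by (intro Bochner_Integration.integral_cong) (auto simp: kernel_section_def space_F)
    finally show ?thesis .
  qed
  have \<mu>_i: "integrable ?P (\<lambda>x. \<mu> (x i))" "(\<integral>x. \<mu> (x i) \<partial>?P) = ip \<mu> \<mu>" for i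
  proof -
    have D: "distr ?P F (\<lambda>x. x i) = F"
      by (rule distr_PiM_component) (auto intro: F.prob_space_axioms)
    show "integrable ?P (\<lambda>x. \<mu> (x i))"
      using \<mu>_int[OF \<mu>_mem] by (intro integrable_distr[OF comp(1)]) (simp add: D)
    have "(\<integral>x. \<mu> (x i) \<partial>?P) = (\<integral>x. \<mu> x \<partial>distr ?P F (\<lambda>x. x i))"
      using \<mu>_int[OF \<mu>_mem] by (intro integral_distr[symmetric] comp) auto
    then show "(\<integral>x. \<mu> (x i) \<partial>?P) = ip \<mu> \<mu>"
      using \<mu>_int[OF \<mu>_mem] by (simp add: D)
  qed
  have k_int: "integrable ?P (\<lambda>x. k (x i) (x j))" for i j
    by (intro integrable_kernel P.prob_space_axioms comp)
  have k_ne: "(\<integral>x. k (x i) (x j) \<partial>?P) = ip \<mu> \<mu>" if "i \<noteq> j" for i j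
  proof -
    have "(\<integral>x. k (x i) (x j) \<partial>?P)
        = (\<integral>(y, z). k y z \<partial>distr ?P (F \<Otimes>\<^sub>M F) (\<lambda>x. (x i, x j)))"
      using kernel_measurable by (subst integral_distr) simp_all
    also have "\<dots> = (\<integral>(y, z). k y z \<partial>(F \<Otimes>\<^sub>M F))"
      by (simp add: distr_PiM_two_components[OF F.prob_space_axioms that])
    also have "\<dots> = (\<integral>y. (\<integral>z. k y z \<partial>F) \<partial>F)"
      using integrable_kernel[OF FF.prob_space_axioms, of fst snd]
      by (intro FF.integral_fst[symmetric]) (simp add: case_prod_beta')
    also have "\<dots> = (\<integral>y. \<mu> y \<partial>F)"
      by (intro Bochner_Integration.integral_cong) (auto simp: \<mu>_eq space_F)
    also have "\<dots> = ip \<mu> \<mu>"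
      using \<mu>_int[OF \<mu>_mem] by simp
    finally show ?thesis .
  qed
  have k_eq: "(\<integral>x. k (x i) (x i) \<partial>?P) \<le> B" for i
    using kernel_diag_le x_in by (intro P.integral_le_const k_int AE_I2) auto
  \<comment> \<open>On the diagonal the nonnegative \<open>ip \<mu> \<mu>\<close> is added for free.
    The copies of \<open>ip \<mu> \<mu>\<close> then cancel in the sum, and the \<open>m\<close>
    diagonal terms leave \<open>m * B / m^2\<close>.\<close>
  have k_le: "(\<integral>x. k (x i) (x j) \<partial>?P) \<le> ip \<mu> \<mu> + (if j = i then B else 0)" for i j
    using k_ne[of i j] k_eq[of i] ip_nonneg[OF \<mu>_mem] by auto
  let ?e = "\<lambda>x. (\<Sum>i<m. \<Sum>j<m. k (x i) (x j)) / (real m * real m)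
    - 2 * ((\<Sum>i<m. \<mu> (x i)) / m) + ip \<mu> \<mu>"
  have e_eq: "sq_error \<mu> m x = ?e x" if "x \<in> space ?P" for x
    using sq_error_eq[OF x_in[OF that] \<mu>_mem] .
  have "integrable ?P ?e"
    using k_int \<mu>_i by simp
  then show "integrable ?P (sq_error \<mu> m)"
    using e_eq by (simp cong: Bochner_Integration.integrable_cong)
  have "(\<integral>x. sq_error \<mu> m x \<partial>?P) = (\<integral>x. ?e x \<partial>?P)"
    using e_eq by (rule Bochner_Integration.integral_cong[OF refl])
  also have "\<dots> = (\<Sum>i<m. \<Sum>j<m. (\<integral>x. k (x i) (x j) \<partial>?P)) / (real m * real m)
      - 2 * ((\<Sum>i<m. (\<integral>x. \<mu> (x i) \<partial>?P)) / m) + ip \<mu> \<mu>"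
    using k_int \<mu>_i(1) by (simp add: P.prob_space)
  also have "\<dots> \<le> (\<Sum>i<m. \<Sum>j<m. ip \<mu> \<mu> + (if j = i then B else 0)) / (real m * real m)
      - 2 * ((\<Sum>i<m. ip \<mu> \<mu>) / m) + ip \<mu> \<mu>"
    unfolding \<mu>_i(2) by (intro add_mono diff_mono divide_right_mono sum_mono k_le) auto
  also have "\<dots> = B / m"
    using \<open>m > 0\<close> by (simp add: sum.distrib field_simps)
  finally show "(\<integral>x. sq_error \<mu> m x \<partial>?P) \<le> B / m" .
qed

text \<open>
  Dropping the diagonal and renormalising changes the \<open>V\<close>-statistic by \<open>O(1/m)\<close>, uniformly in
  the sample.
\<close>

lemma u_statistic_v_statistic:
  assumes x: "\<And>i. x i \<in> space X" and "m \<ge> 2"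
  shows "\<bar>(\<Sum>i<m. \<Sum>j\<in>{..<m} - {i}. k (x i) (x j)) / (real m * (real m - 1))
    - (\<Sum>i<m. \<Sum>j<m. k (x i) (x j)) / (real m * real m)\<bar> \<le> 2 * B / m"
proof -
  define U where "U = (\<Sum>i<m. \<Sum>j\<in>{..<m} - {i}. k (x i) (x j))"
  define D where "D = (\<Sum>i<m. k (x i) (x i))"
  have split: "(\<Sum>i<m. \<Sum>j<m. k (x i) (x j)) = U + D"
    unfolding U_def D_def by (simp add: sum_diff1 flip: sum.distrib)
  have "\<bar>U\<bar> \<le> (\<Sum>i<m. \<Sum>j\<in>{..<m} - {i}. B)"
    unfolding U_def using x
    by (intro order_trans[OF sum_abs] sum_mono abs_kernel_le_bound)
  also have "\<dots> = real m * (real m - 1) * B"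
    using \<open>m \<ge> 2\<close> by (simp add: of_nat_diff)
  finally have U: "\<bar>U\<bar> \<le> real m * (real m - 1) * B" .
  have D: "\<bar>D\<bar> \<le> real m * B"
    unfolding D_def using sum_mono[of "{..<m}" "\<lambda>i. \<bar>k (x i) (x i)\<bar>" "\<lambda>_. B"]
      abs_kernel_le_bound x by (intro order_trans[OF sum_abs]) simp
  \<comment> \<open>The two normalisations satisfy 1/(m(m-1)) - 1/m^2 = 1/(m(m-1)) * 1/m, so the
    off-diagonal part and the diagonal part contribute at most \<open>B / m\<close> each.\<close>
  have "U / (real m * (real m - 1)) - (U + D) / (real m * real m)
      = U / (real m * (real m - 1)) / m - D / (real m * real m)"
    using \<open>m \<ge> 2\<close> by (simp add: field_simps)
  moreover have "\<bar>U / (real m * (real m - 1)) / m\<bar> \<le> B / m"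
  proof -
    have "\<bar>U / (real m * (real m - 1))\<bar> \<le> B"
      using U \<open>m \<ge> 2\<close> by (simp add: abs_mult field_simps)
    then show ?thesis
      by (simp only: abs_divide abs_of_nat divide_right_mono of_nat_0_le_iff)
  qed
  moreover have "\<bar>D / (real m * real m)\<bar> \<le> B / m"
    using D \<open>m \<ge> 2\<close> by (simp add: abs_mult field_simps)
  ultimately show ?thesis
    unfolding split U_def[symmetric] by linarith
qed

text \<open>The difference of the empirical embeddings is \<open>v + w\<close>, with
  \<open>v\<close> the true difference and \<open>w\<close> the difference of the two errors.
  Expanding its squared norm and applying the weighted inequality to the cross term charges
  \<open>\<delta> * \<theta>\<close> to the signal and the rest to the errors; replacing
  \<open>V\<close>- by \<open>U\<close>-statistics adds the first two terms.\<close>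

lemma mmd_u_sq_deviation:
  assumes x: "\<And>i. x i \<in> space X" and y: "\<And>i. y i \<in> space X"
    and \<mu>: "\<mu> \<in> H" and \<nu>: "\<nu> \<in> H" and "m \<ge> 2" "n \<ge> 2" "\<delta> > 0"
    and \<theta>: "\<theta> = ip (\<lambda>z. \<mu> z - \<nu> z) (\<lambda>z. \<mu> z - \<nu> z)"
  shows "\<bar>mmd_u_sq k m n (x, y) - \<theta>\<bar>
    \<le> 2 * B / m + 2 * B / n + \<delta> * \<theta> + (1 + 1 / \<delta>) * (2 * (sq_error \<mu> m x + sq_error \<nu> n y))"
proof -
  let ?p = "empirical_embedding m x" and ?q = "empirical_embedding n y"
  note p = empirical_embedding_mem[OF x, of m] and q = empirical_embedding_mem[OF y, of n]
  define a where "a = (\<lambda>z. ?p z - \<mu> z)"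
  define b where "b = (\<lambda>z. ?q z - \<nu> z)"
  define v where "v = (\<lambda>z. \<mu> z - \<nu> z)"
  define w where "w = (\<lambda>z. a z - b z)"
  have mem: "a \<in> H" "b \<in> H" "v \<in> H" "w \<in> H"
    unfolding a_def b_def v_def w_def by (intro diff_mem p q \<mu> \<nu>)+
  have "(\<lambda>z. ?p z - ?q z) = (\<lambda>z. v z + w z)"
    by (simp add: v_def w_def a_def b_def fun_eq_iff)
  then have pq: "ip (\<lambda>z. ?p z - ?q z) (\<lambda>z. ?p z - ?q z) = \<theta> + 2 * ip v w + ip w w"
    using mem by (simp add: ip_add_add \<theta> v_def)
  have "ip w w \<le> 2 * (ip a a + ip b b)"
    using mem two_ip_le_weighted[of a b 1] by (simp add: w_def ip_diff_diff)
  then have "(1 + 1 / \<delta>) * ip w w \<le> (1 + 1 / \<delta>) * (2 * (ip a a + ip b b))"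
    using \<open>\<delta> > 0\<close> by (intro mult_left_mono) auto
  moreover have "2 * \<bar>ip v w\<bar> \<le> \<delta> * \<theta> + ip w w / \<delta>"
    using two_ip_le_weighted[OF mem(3,4) \<open>\<delta> > 0\<close>] by (simp add: \<theta> v_def)
  ultimately have "\<bar>ip (\<lambda>z. ?p z - ?q z) (\<lambda>z. ?p z - ?q z) - \<theta>\<bar>
      \<le> \<delta> * \<theta> + (1 + 1 / \<delta>) * (2 * (ip a a + ip b b))"
    using ip_nonneg[OF mem(4)] unfolding pq by (simp add: distrib_right)
  moreover have "ip (\<lambda>z. ?p z - ?q z) (\<lambda>z. ?p z - ?q z)
      = (\<Sum>i<m. \<Sum>j<m. k (x i) (x j)) / (real m * real m)
      - 2 * (\<Sum>i<m. \<Sum>j<n. k (x i) (y j)) / (real m * real n)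
      + (\<Sum>i<n. \<Sum>j<n. k (y i) (y j)) / (real n * real n)"
    by (simp add: ip_diff_diff p q ip_empirical_empirical x y)
  ultimately show ?thesis
    using u_statistic_v_statistic[of x m, OF x \<open>m \<ge> 2\<close>] u_statistic_v_statistic[of y n, OF y \<open>n \<ge> 2\<close>]
    unfolding mmd_u_sq_def prod.case sq_error_def a_def b_def by linarith
qed

section \<open>Convergence in probability of the estimator\<close>

lemma mmd_u_sq_measurable:
  assumes "F \<in> distributions X" "G \<in> distributions X"
  shows "mmd_u_sq k m n \<in> borel_measurable (two_sample (F, G))"
proof -
  note [measurable_cong] = distributionsD(2)[OF assms(1)] distributionsD(2)[OF assms(2)]
  have [measurable]: "(\<lambda>\<omega>. fst \<omega> i) \<in> measurable (two_sample (F, G)) X"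
    "(\<lambda>\<omega>. snd \<omega> i) \<in> measurable (two_sample (F, G)) X" for i
    unfolding two_sample_def prod.case by measurable
  note [measurable] = kernel_measurable'
  show ?thesis
    unfolding mmd_u_sq_def case_prod_beta' by measurable
qed

text \<open>By \<open>small\<close> the deterministic part of the deviation uses up at most
  \<open>e / 2\<close>, so a deviation beyond \<open>e\<close> forces the random part to reach
  \<open>e / 2\<close>. Markov's inequality and the expected squared errors bound that
  probability.\<close>

lemma measure_mmd_u_sq_deviation_le:
  assumes F: "F \<in> distributions X" and G: "G \<in> distributions X"
    and \<mu>: "is_mean_embedding H ip F \<mu>" and \<nu>: "is_mean_embedding H ip G \<nu>"
    and \<theta>: "\<theta> = ip (\<lambda>z. \<mu> z - \<nu> z) (\<lambda>z. \<mu> z - \<nu> z)"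
    and "m \<ge> 2" "n \<ge> 2" "\<delta> > 0" "e > 0"
    and small: "2 * B / m + 2 * B / n + \<delta> * \<theta> \<le> e / 2"
  shows "measure (two_sample (F, G)) {\<omega> \<in> space (two_sample (F, G)). \<bar>mmd_u_sq k m n \<omega> - \<theta>\<bar> > e}
    \<le> 4 * (1 + 1 / \<delta>) / e * (B / m + B / n)"
proof -
  let ?P = "\<Pi>\<^sub>M i\<in>(UNIV :: nat set). F" and ?Q = "\<Pi>\<^sub>M i\<in>(UNIV :: nat set). G"
  let ?T = "two_sample (F, G)"
  have T: "?T = ?P \<Otimes>\<^sub>M ?Q" by (simp add: two_sample_def)
  interpret P: prob_space ?P using distributionsD(1)[OF F] by (intro prob_space_PiM)
  interpret Q: prob_space ?Q using distributionsD(1)[OF G] by (intro prob_space_PiM)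
  interpret PQ: pair_prob_space ?P ?Q ..
  have mem: "\<mu> \<in> H" "\<nu> \<in> H"
    using \<mu> \<nu> by (auto simp: is_mean_embedding_def)
  have in_X: "fst \<omega> i \<in> space X" "snd \<omega> i \<in> space X" if "\<omega> \<in> space ?T" for \<omega> i
    using that distributionsD(3)[OF F] distributionsD(3)[OF G]
    by (auto simp: T space_pair_measure space_PiM)
  let ?a = "\<lambda>\<omega> :: (nat \<Rightarrow> 'x) \<times> (nat \<Rightarrow> 'x). sq_error \<mu> m (fst \<omega>)"
  let ?b = "\<lambda>\<omega> :: (nat \<Rightarrow> 'x) \<times> (nat \<Rightarrow> 'x). sq_error \<nu> n (snd \<omega>)"
  have a: "integrable ?P (sq_error \<mu> m)" "(\<integral>x. sq_error \<mu> m x \<partial>?P) \<le> B / m"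
    using expected_sq_error[OF F \<mu>] \<open>m \<ge> 2\<close> by auto
  have b: "integrable ?Q (sq_error \<nu> n)" "(\<integral>x. sq_error \<nu> n x \<partial>?Q) \<le> B / n"
    using expected_sq_error[OF G \<nu>] \<open>n \<ge> 2\<close> by auto
  \<comment> \<open>Each squared error depends on one sample only, so its expectation can be taken
    under that marginal.\<close>
  have D1: "distr ?T ?P fst = ?P" and D2: "distr ?T ?Q snd = ?Q"
    unfolding T by (rule Q.distr_pair_fst, rule distr_pair_snd[OF P.prob_space_axioms Q.prob_space_axioms])
  have m1: "fst \<in> measurable ?T ?P" and m2: "snd \<in> measurable ?T ?Q"
    unfolding T by (rule measurable_fst, rule measurable_snd)
  have a': "integrable ?T ?a" "(\<integral>\<omega>. ?a \<omega> \<partial>?T) \<le> B / m"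
    using integrable_distr[OF m1, of "sq_error \<mu> m"] integral_distr[OF m1, of "sq_error \<mu> m"] a
    by (auto simp: D1)
  have b': "integrable ?T ?b" "(\<integral>\<omega>. ?b \<omega> \<partial>?T) \<le> B / n"
    using integrable_distr[OF m2, of "sq_error \<nu> n"] integral_distr[OF m2, of "sq_error \<nu> n"] b
    by (auto simp: D2)
  let ?K = "2 * (1 + 1 / \<delta>)"
  let ?u = "\<lambda>\<omega>. ?K * (?a \<omega> + ?b \<omega>)"
  have K: "?K \<ge> 0" using \<open>\<delta> > 0\<close> by simp
  have u: "integrable ?T ?u" using a'(1) b'(1) by simp
  have sub: "{\<omega> \<in> space ?T. \<bar>mmd_u_sq k m n \<omega> - \<theta>\<bar> > e} \<subseteq> {\<omega> \<in> space ?T. ?u \<omega> \<ge> e / 2}"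
  proof safe
    fix x y assume xy: "(x, y) \<in> space ?T" and dev: "e < \<bar>mmd_u_sq k m n (x, y) - \<theta>\<bar>"
    have "\<bar>mmd_u_sq k m n (x, y) - \<theta>\<bar>
        \<le> 2 * B / m + 2 * B / n + \<delta> * \<theta> + (1 + 1 / \<delta>) * (2 * (sq_error \<mu> m x + sq_error \<nu> n y))"
      using in_X[OF xy]
      by (intro mmd_u_sq_deviation mem \<theta> \<open>m \<ge> 2\<close> \<open>n \<ge> 2\<close> \<open>\<delta> > 0\<close>) auto
    then show "e / 2 \<le> ?K * (sq_error \<mu> m (fst (x, y)) + sq_error \<nu> n (snd (x, y)))"
      using dev small by (simp only: fst_conv snd_conv mult.assoc[symmetric] mult.commute[of 2])
  qed
  have "measure ?T {\<omega> \<in> space ?T. \<bar>mmd_u_sq k m n \<omega> - \<theta>\<bar> > e} \<le> measure ?T {\<omega> \<in> space ?T. ?u \<omega> \<ge> e / 2}"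
  proof (rule finite_measure.finite_measure_mono[OF _ sub])
    show "finite_measure ?T" unfolding T by (rule PQ.finite_measure_axioms)
    have [measurable]: "?u \<in> borel_measurable ?T" using u by (rule borel_measurable_integrable)
    show "{\<omega> \<in> space ?T. ?u \<omega> \<ge> e / 2} \<in> sets ?T" by measurable
  qed
  also have "\<dots> \<le> (\<integral>\<omega>. ?u \<omega> \<partial>?T) / (e / 2)"
  proof (rule integral_Markov_inequality_measure[OF u, of "{}"])
    show "AE \<omega> in ?T. 0 \<le> ?u \<omega>"
      by (intro AE_I2 mult_nonneg_nonneg[OF K] add_nonneg_nonneg sq_error_nonneg mem in_X)
  qed (use \<open>e > 0\<close> in auto)
  also have "(\<integral>\<omega>. ?u \<omega> \<partial>?T) = ?K * ((\<integral>\<omega>. ?a \<omega> \<partial>?T) + (\<integral>\<omega>. ?b \<omega> \<partial>?T))"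
    using a'(1) b'(1) by simp
  also have "\<dots> / (e / 2) \<le> ?K * (B / m + B / n) / (e / 2)"
    using a'(2) b'(2) K \<open>e > 0\<close> by (intro divide_right_mono mult_left_mono add_mono) auto
  also have "\<dots> = 4 * (1 + 1 / \<delta>) / e * (B / m + B / n)"
    using times_divide_times_eq[of "?K * (B / m + B / n)" 2 e 2] \<open>e > 0\<close> by (simp add: mult.commute)
  finally show ?thesis .
qed

lemma mmd_u_sq_consistent:
  assumes char: "characteristic X H ip"
  shows "consistent_for (distribution_space X) (mmd_u_sq k) (mmd_sq H ip)"
  unfolding consistent_for_def
proof (intro ballI conjI allI impI)
  fix p assume "p \<in> distribution_space X"
  then obtain F G where p: "p = (F, G)" and F: "F \<in> distributions X" and G: "G \<in> distributions X"
    by (auto simp: distribution_space_def)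
  show "mmd_u_sq k m n \<in> borel_measurable (two_sample p)" for m n
    unfolding p by (rule mmd_u_sq_measurable[OF F G])
  fix e :: real assume "e > 0"
  let ?\<mu> = "mean_embedding H ip F" and ?\<nu> = "mean_embedding H ip G"
  note \<mu> = is_mean_embedding_mean_embedding[OF char F]
    and \<nu> = is_mean_embedding_mean_embedding[OF char G]
  define \<theta> where "\<theta> = mmd_sq H ip p"
  have \<theta>: "\<theta> = ip (\<lambda>z. ?\<mu> z - ?\<nu> z) (\<lambda>z. ?\<mu> z - ?\<nu> z)"
    by (simp add: \<theta>_def p mmd_sq_def Let_def)
  have "\<theta> \<ge> 0"
    using \<mu> \<nu> unfolding \<theta> by (intro ip_nonneg diff_mem) (auto simp: is_mean_embedding_def)
  \<comment> \<open>Half of the budget \<open>e / 2\<close> goes to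
    \<open>\<delta> * \<theta>\<close>, the other half to the terms in \<open>B\<close>. Adding 1
    keeps the denominator positive when \<open>\<theta>\<close> is 0, and \<open>\<delta>\<close>
    stays fixed while the sample sizes grow.\<close>
  define \<delta> where "\<delta> = e / (4 * (\<theta> + 1))"
  have \<delta>: "\<delta> > 0" "\<delta> * \<theta> \<le> e / 4"
    using \<open>\<theta> \<ge> 0\<close> \<open>e > 0\<close> by (auto simp: \<delta>_def field_simps)
  have inv: "((\<lambda>(m, n). c / real m + c / real n) \<longlongrightarrow> 0) (sequentially \<times>\<^sub>F sequentially)" for c
  proof -
    have c: "(\<lambda>n. c / real n) \<longlonglongrightarrow> 0" by (rule lim_const_over_n)
    show ?thesis
      using tendsto_add[OF filterlim_compose[OF c filterlim_fst] filterlim_compose[OF c filterlim_snd]]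
      by (simp add: case_prod_beta')
  qed
  have "\<forall>\<^sub>F (m, n) in sequentially \<times>\<^sub>F sequentially. 2 * B / real m + 2 * B / real n < e / 4"
    using order_tendstoD(2)[OF inv, of "e / 4" "2 * B"] \<open>e > 0\<close> by (simp add: case_prod_beta')
  moreover have "\<forall>\<^sub>F (m, n) in sequentially \<times>\<^sub>F sequentially. m \<ge> 2 \<and> n \<ge> (2 :: nat)"
    by (auto simp: eventually_prod_sequentially)
  ultimately have le: "\<forall>\<^sub>F (m, n) in sequentially \<times>\<^sub>F sequentially.
      measure (two_sample p) {\<omega> \<in> space (two_sample p). \<bar>mmd_u_sq k m n \<omega> - \<theta>\<bar> > e}
      \<le> 4 * (1 + 1 / \<delta>) / e * (B / m + B / n)"
  proof eventually_elim
    case (elim mn)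
    obtain m n where mn: "mn = (m, n)" by fastforce
    then have "2 * B / real m + 2 * B / real n < e / 4" "m \<ge> 2" "n \<ge> 2"
      using elim by auto
    then show ?case
      unfolding mn prod.case p
      using \<delta> \<open>e > 0\<close> by (intro measure_mmd_u_sq_deviation_le[OF F G \<mu> \<nu> \<theta>]) auto
  qed
  have lim: "((\<lambda>(m, n). 4 * (1 + 1 / \<delta>) / e * (B / real m + B / real n)) \<longlongrightarrow> 0)
      (sequentially \<times>\<^sub>F sequentially)"
    using tendsto_mult_right_zero[OF inv, of "4 * (1 + 1 / \<delta>) / e" B] by (simp add: case_prod_beta')
  show "((\<lambda>(m, n). measure (two_sample p)
      {\<omega> \<in> space (two_sample p). \<bar>mmd_u_sq k m n \<omega> - mmd_sq H ip p\<bar> > e}) \<longlongrightarrow> 0)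
      (sequentially \<times>\<^sub>F sequentially)"
    unfolding \<theta>_def[symmetric]
  proof (rule tendsto_sandwich[OF _ _ tendsto_const lim])
    show "\<forall>\<^sub>F mn in sequentially \<times>\<^sub>F sequentially. 0 \<le> (case mn of (m, n) \<Rightarrow>
        measure (two_sample p) {\<omega> \<in> space (two_sample p). \<bar>mmd_u_sq k m n \<omega> - \<theta>\<bar> > e})"
      by (intro always_eventually) (simp add: case_prod_beta')
    show "\<forall>\<^sub>F mn in sequentially \<times>\<^sub>F sequentially. (case mn of (m, n) \<Rightarrow>
        measure (two_sample p) {\<omega> \<in> space (two_sample p). \<bar>mmd_u_sq k m n \<omega> - \<theta>\<bar> > e})
        \<le> (case mn of (m, n) \<Rightarrow> 4 * (1 + 1 / \<delta>) / e * (B / real m + B / real n))"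
      using le by (simp add: case_prod_beta')
  qed
qed

end

theorem mainTheorem9:
  fixes X :: "'x measure"
    and k :: "'x \<Rightarrow> 'x \<Rightarrow> real"
    and H :: "('x \<Rightarrow> real) set"
    and ip :: "('x \<Rightarrow> real) \<Rightarrow> ('x \<Rightarrow> real) \<Rightarrow> real"
  assumes "rkhs X k H ip"
    and "characteristic X H ip"
  shows "universally_detection_coherent
           (distribution_space X) (equality_null X) (mmd_u_sq k) (mmd_sq H ip) 0
       \<and> detection_null (distribution_space X) (mmd_sq H ip) 0 = equality_null X
       \<and> blind_spot (distribution_space X) (equality_null X) (mmd_sq H ip) 0 = {}"
proof -
  interpret rkhs X k H ip by fact
  obtain B where "\<And>x. x \<in> space X \<Longrightarrow> k x x \<le> B"
    using characteristic_kernel_diag_bounded[OF assms(2)] by blast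
  \<comment> \<open>The maximum secures a nonnegative bound even over an empty sample space.\<close>
  then interpret bounded_rkhs X k H ip "max B 0"
    by unfold_locales (auto simp: le_max_iff_disj)
  have null: "detection_null (distribution_space X) (mmd_sq H ip) 0 = equality_null X"
    using mmd_sq_eq_0_iff[OF assms(2)]
    by (auto simp: detection_null_def equality_null_def distribution_space_def)
  then have "detection_test (distribution_space X) (equality_null X) (mmd_u_sq k) (mmd_sq H ip) 0"
    using mmd_u_sq_consistent[OF assms(2)] by (auto simp: detection_test_def detection_null_def)
  with null show ?thesis
    by (simp add: universally_detection_coherent_def blind_spot_def)
qed

end
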